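(* Let $\mathbb M=\mathbb R^4$ be Minkowski space and let $P$ be the lattice of subsets of $\mathbb M$ generated (under finite unions and intersections) by the closed diamonds $\Diamond(p,q)$ with $p,q\in\mathbb Q^4$, $p\leqslant q$. Let $\pi$ be the family of all maximal (with respect to inclusion) centered subsets of $P$. Let $X=\pi$, and let $\tau$ be the topology on $X$ having the family $\{\pi(A)\mid A\in P\}$ as a subbase for its closed sets, where $\pi(A)=\{U\in\pi\mid A\in U\}$. Then $(X,\tau)$ is homeomorphic to $\mathbb M$ equipped with the co-compact topology $\tau_E^G$.
   Context: On $\mathbb M=\mathbb R^4$ let $\eta$ be the Minkowski bilinear form represented in the standard basis by the diagonal matrix with diagonal entries $(1,-1,-1,-1)$; the first coordinate is the time coordinate. Define $p\leqslant q$ if the time coordinate of $q-p$ is non-negative and $\eta(q-p,q-p)\ge 0$. Put $J^+(p)=\{x\in\mathbb M\mid p\leqslant x\}$, $J^-(p)=\{x\in\mathbb M\mid x\leqslant p\}$, and $\Diamond(p,q)=J^+(p)\cap J^-(q)$ for $p\leqslant q$. A subset $F\subseteq P$ is centered if for every finitely many $A_1,\dots,A_k\in F$ there exists $B\in P$, $B\neq\varnothing$, with $B\subseteq A_i$ for every $i=1,\dots,k$. $\tau_E$ denotes the Euclidean topology on $\mathbb M$. For a topological space $(Y,\sigma)$, the co-compact (de Groot dual) topology $\sigma^G$ is the topology on $Y$ generated by the family of all compact saturated subsets of $(Y,\sigma)$ used as a base for the closed sets; a set is saturated if it is an intersection of open sets (in a $T_1$ space such as $(\mathbb M,\tau_E)$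 all sets are saturated). The co-compact topology on $\mathbb M$ is $\tau_E^G$. *)

theory Defs
  imports "HOL-Analysis.Analysis"
begin

section \<open>Minkowski space and closed diamonds\<close>

text \<open>The index type \<open>4\<close> has elements \<open>1, 2, 3, 4\<close> (with \<open>4 = 0\<close>); time is the component \<open>x $ 1\<close>.\<close>

definition minkowski_matrix :: "real^4^4" where
  "minkowski_matrix = (\<chi> i j. if i \<noteq> j then 0 else if i = 1 then 1 else - 1)"

definition minkowski_form :: "real^4 \<Rightarrow> real^4 \<Rightarrow> real" where
  "minkowski_form x y = x \<bullet> (minkowski_matrix *v y)"

definition causal_le :: "real^4 \<Rightarrow> real^4 \<Rightarrow> bool" where
  "causal_le p q \<longleftrightarrow> (q - p) $ 1 \<ge> 0 \<and> minkowski_form (q - p) (q - p) \<ge> 0"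

definition causal_future :: "real^4 \<Rightarrow> (real^4) set" where
  "causal_future p = {x. causal_le p x}"

definition causal_past :: "real^4 \<Rightarrow> (real^4) set" where
  "causal_past p = {x. causal_le x p}"

definition diamond :: "real^4 \<Rightarrow> real^4 \<Rightarrow> (real^4) set" where
  "diamond p q = causal_future p \<inter> causal_past q"

definition rational_diamonds :: "(real^4) set set" where
  "rational_diamonds =
     {diamond p q | p q. (\<forall>i. p $ i \<in> \<rat>) \<and> (\<forall>i. q $ i \<in> \<rat>) \<and> causal_le p q}"

lemma minkowski_form_coords:
  "minkowski_form x y = x$1 * y$1 - x$2 * y$2 - x$3 * y$3 - x$4 * y$4"
  by (simp add: minkowski_form_def minkowski_matrix_def inner_vec_def
      matrix_vector_mult_def sum_4)

section \<open>Generated lattices and maximal centered families\<close>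

inductive_set set_lattice_generated_by :: "'a set set \<Rightarrow> 'a set set" for G where
  base: "A \<in> G \<Longrightarrow> A \<in> set_lattice_generated_by G"
| union: "\<lbrakk>A \<in> set_lattice_generated_by G; B \<in> set_lattice_generated_by G\<rbrakk>
    \<Longrightarrow> A \<union> B \<in> set_lattice_generated_by G"
| inter: "\<lbrakk>A \<in> set_lattice_generated_by G; B \<in> set_lattice_generated_by G\<rbrakk>
    \<Longrightarrow> A \<inter> B \<in> set_lattice_generated_by G"

definition centered :: "'a set set \<Rightarrow> 'a set set \<Rightarrow> bool" where
  "centered P F \<longleftrightarrow> F \<subseteq> P \<and>
     (\<forall>K. finite K \<and> K \<subseteq> F \<longrightarrow> (\<exists>B\<in>P. B \<noteq> {} \<and> (\<forall>A\<in>K. B \<subseteq> A)))"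

definition maximal_centered :: "'a set set \<Rightarrow> 'a set set set" where
  "maximal_centered P =
     {U. centered P U \<and> (\<forall>V. centered P V \<and> U \<subseteq> V \<longrightarrow> V = U)}"

definition maximal_centered_containing :: "'a set set \<Rightarrow> 'a set \<Rightarrow> 'a set set set" where
  "maximal_centered_containing P A = {U \<in> maximal_centered P. A \<in> U}"

text \<open>The carrier itself is inserted because it is always open, as the complement of the empty
  union, and \<^const>\<open>topology_generated_by\<close> takes the union of its argument as carrier.\<close>

definition closed_subbase_topology :: "'a set \<Rightarrow> 'a set set \<Rightarrow> 'a topology" where
  "closed_subbase_topology X \<C> = topology_generated_by (insert X ((\<lambda>C. X - C) ` \<C>))"

lemma topspace_closed_subbase_topology [simp]:
  "topspace (closed_subbase_topology X \<C>) = X"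
  by (auto simp: closed_subbase_topology_def)

definition maximal_centered_topology :: "'a set set \<Rightarrow> 'a set set topology" where
  "maximal_centered_topology P =
     closed_subbase_topology (maximal_centered P) (maximal_centered_containing P ` P)"

section \<open>The co-compact (de Groot dual) topology\<close>

definition saturatedin :: "'a topology \<Rightarrow> 'a set \<Rightarrow> bool" where
  "saturatedin Y S \<longleftrightarrow> (\<exists>\<U>. (\<forall>U\<in>\<U>. openin Y U) \<and> S = topspace Y \<inter> \<Inter>\<U>)"

text \<open>A family is a base for the closed sets iff the complements of its members are a base for
  the open sets.\<close>

definition cocompact_topology :: "'a topology \<Rightarrow> 'a topology" where
  "cocompact_topology Y = topology (arbitrary union_of
     (\<lambda>U. \<exists>K. compactin Y K \<and> saturatedin Y K \<and> U = topspace Y - K))"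

lemma saturatedin_Un:
  assumes "saturatedin Y S" "saturatedin Y T"
  shows "saturatedin Y (S \<union> T)"
proof -
  obtain \<U> \<V> where U: "\<forall>U\<in>\<U>. openin Y U" "S = topspace Y \<inter> \<Inter>\<U>"
    and V: "\<forall>V\<in>\<V>. openin Y V" "T = topspace Y \<inter> \<Inter>\<V>"
    using assms unfolding saturatedin_def by blast
  have "S \<union> T = topspace Y \<inter> \<Inter>{U \<union> V | U V. U \<in> \<U> \<and> V \<in> \<V>}"
    unfolding U(2) V(2) by blast
  moreover have "\<forall>W\<in>{U \<union> V | U V. U \<in> \<U> \<and> V \<in> \<V>}. openin Y W"
    using U(1) V(1) by blast
  ultimately show ?thesis
    unfolding saturatedin_def by blast
qed

text \<open>The family of open sets above is indeed a topology, so \<^const>\<open>topology\<close> represents it.\<close>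

lemma openin_cocompact_topology:
  "openin (cocompact_topology Y) = arbitrary union_of
     (\<lambda>U. \<exists>K. compactin Y K \<and> saturatedin Y K \<and> U = topspace Y - K)"
proof -
  have "istopology (arbitrary union_of
     (\<lambda>U. \<exists>K. compactin Y K \<and> saturatedin Y K \<and> U = topspace Y - K))"
  proof (rule istopology_base)
    fix S T
    assume "\<exists>K. compactin Y K \<and> saturatedin Y K \<and> S = topspace Y - K"
      and "\<exists>K. compactin Y K \<and> saturatedin Y K \<and> T = topspace Y - K"
    then obtain K L where "compactin Y K" "saturatedin Y K" "S = topspace Y - K"
      and "compactin Y L" "saturatedin Y L" "T = topspace Y - L"
      by blast
    then have "compactin Y (K \<union> L) \<and> saturatedin Y (K \<union> L) \<and> S \<inter> T = topspace Y - (K \<union> L)"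
      by (auto intro: compactin_Un saturatedin_Un)
    then show "\<exists>K. compactin Y K \<and> saturatedin Y K \<and> S \<inter> T = topspace Y - K"
      by blast
  qed
  then show ?thesis
    by (simp add: cocompact_topology_def topology_inverse')
qed

lemma topspace_cocompact_topology [simp]: "topspace (cocompact_topology Y) = topspace Y"
proof
  show "topspace (cocompact_topology Y) \<subseteq> topspace Y"
    unfolding topspace_def[of "cocompact_topology Y"] openin_cocompact_topology union_of_def
    by blast
  have "saturatedin Y {}"
    unfolding saturatedin_def by (rule exI[of _ "{{}}"]) simp
  then have "\<exists>K. compactin Y K \<and> saturatedin Y K \<and> topspace Y = topspace Y - K"
    by (intro exI[of _ "{}"]) simp
  then have "openin (cocompact_topology Y) (topspace Y)"
    unfolding openin_cocompact_topology by (rule arbitrary_union_of_inc)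
  then show "topspace Y \<subseteq> topspace (cocompact_topology Y)"
    by (rule openin_subset)
qed

end

theory Submission
  imports Defs
begin

text \<open>By compactness, every centered family of compact sets is contained in the family of all
  members of \<open>P\<close> through some point, and since small diamonds separate points these
  families are exactly the maximal centered ones. This identifies \<open>X\<close> with \<open>\<real>\<^sup>4\<close> so that
  \<open>\<pi>(A)\<close> corresponds to \<open>A\<close>. The two topologies then agree because every compact set
  is an intersection of members of \<open>P\<close>: cover it by finitely many rational diamonds inside a
  given neighbourhood.\<close>

section \<open>Point families and co-compact open sets\<close>

definition members_through :: "'a set set \<Rightarrow> 'a \<Rightarrow> 'a set set" where
  "members_through P x = {A \<in> P. x \<in> A}"

text \<open>Complements of points are open in a T1 space, and \<open>S\<close> is the intersection
  of those over the points outside it.\<close>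

lemma saturatedin_euclidean: "saturatedin (euclidean :: 'a::t1_space topology) S"
  unfolding saturatedin_def
  by (rule exI[of _ "(\<lambda>y. - {y}) ` (- S)"]) auto

lemma openin_cocompact_euclidean_Compl:
  fixes K :: "'a::t1_space set"
  assumes "compact K"
  shows "openin (cocompact_topology euclidean) (- K)"
  unfolding openin_cocompact_topology
  by (rule arbitrary_union_of_inc)
     (use assms in \<open>auto simp: compactin_euclidean_iff saturatedin_euclidean Compl_eq_Diff_UNIV\<close>)

text \<open>Isolates the topological properties of the diamond lattice.
  \<open>small_neighbourhood\<close> asks for neighbourhoods, not mere membership, so that interiors
  of members can form open covers.\<close>

locale compact_neighbourhood_lattice =
  fixes P :: "'a::t2_space set set"
  assumes compact: "A \<in> P \<Longrightarrow> compact A"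
    and Un_closed: "A \<in> P \<Longrightarrow> B \<in> P \<Longrightarrow> A \<union> B \<in> P"
    and Int_closed: "A \<in> P \<Longrightarrow> B \<in> P \<Longrightarrow> A \<inter> B \<in> P"
    and small_neighbourhood: "open U \<Longrightarrow> x \<in> U \<Longrightarrow> \<exists>A\<in>P. x \<in> interior A \<and> A \<subseteq> U"
begin

section \<open>Maximal centered families as points\<close>

lemma Inter_closed:
  assumes "finite K" "K \<noteq> {}" "K \<subseteq> P"
  shows "\<Inter>K \<in> P"
  using assms by (induction K rule: finite_ne_induct) (auto intro: Int_closed)

text \<open>\<open>K\<close> is nonempty because the locale does not put \<open>{}\<close> into
  \<open>P\<close>; for intersections, \<open>\<Inter>{}\<close> would be the whole space, which may
  fail to be compact.\<close>

lemma Union_closed: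
  assumes "finite K" "K \<noteq> {}" "K \<subseteq> P"
  shows "\<Union>K \<in> P"
  using assms by (induction K rule: finite_ne_induct) (auto intro: Un_closed)

lemma separating_member:
  assumes "x \<noteq> y"
  obtains A where "A \<in> P" "x \<in> A" "y \<notin> A"
proof -
  obtain A where "A \<in> P" "x \<in> interior A" "A \<subseteq> - {y}"
    using small_neighbourhood[of "- {y}" x] assms by auto
  then show thesis
    using that interior_subset by blast
qed

text \<open>A member through \<open>x\<close> that misses \<open>y\<close> would break the
  inclusion. This antichain property yields both maximality and injectivity.\<close>

lemma members_through_subset_imp_eq:
  assumes "members_through P x \<subseteq> members_through P y"
  shows "x = y"
  using assms separating_member[of x y] unfolding members_through_def by blast

lemma centered_members_through: "centered P (members_through P x)"
  unfolding centered_def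
proof (intro conjI allI impI)
  show "members_through P x \<subseteq> P"
    by (auto simp: members_through_def)
next
  fix K assume K: "finite K \<and> K \<subseteq> members_through P x"
  show "\<exists>B\<in>P. B \<noteq> {} \<and> (\<forall>A\<in>K. B \<subseteq> A)"
  proof (cases "K = {}")
    case True
    \<comment> \<open>Even the empty \<open>K\<close> requires a nonempty member of
      \<open>P\<close>; any neighbourhood of \<open>x\<close> serves.\<close>
    obtain A where "A \<in> P" "x \<in> interior A"
      using small_neighbourhood[of UNIV x] by auto
    with True show ?thesis
      using interior_subset by auto
  next
    case False
    with K have "\<Inter>K \<in> P" "x \<in> \<Inter>K"
      by (auto simp: members_through_def intro!: Inter_closed)
    then show ?thesis
      by blast
  qed
qed

lemma centered_subset_members_through:
  assumes "centered P F"
  obtains x where "F \<subseteq> members_through P x"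
proof (cases "F = {}")
  case True
  then show thesis
    using that by blast
next
  case False
  then obtain A where "A \<in> F"
    by blast
  have FP: "F \<subseteq> P"
    using assms by (simp add: centered_def)
  \<comment> \<open>One member \<open>A\<close> is the compact set in which the finite intersection
    property is applied. Adding \<open>A\<close> to each finite \<open>K\<close> puts the witness
    \<open>B\<close> inside \<open>A\<close> as well.\<close>
  have "A \<inter> \<Inter>F \<noteq> {}"
  proof (rule compact_imp_fip)
    show "compact A"
      using compact \<open>A \<in> F\<close> FP by blast
    show "closed T" if "T \<in> F" for T
      using compact compact_imp_closed that FP by blast
    fix K assume "finite K" "K \<subseteq> F"
    then have "finite (insert A K)" "insert A K \<subseteq> F"
      using \<open>A \<in> F\<close> by auto
    then obtain B where "B \<noteq> {}" "\<forall>C\<in>insert A K. B \<subseteq> C"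
      using assms unfolding centered_def by meson
    then show "A \<inter> \<Inter>K \<noteq> {}"
      by blast
  qed
  with FP show thesis
    using that unfolding members_through_def by blast
qed

text \<open>A maximal family lies in a point family, which is centered, so they agree. Conversely, a
  centered \<open>V\<close> above the family of \<open>x\<close> lies below that of some
  \<open>y\<close>; then \<open>x = y\<close> and \<open>V\<close> is squeezed.\<close>

lemma maximal_centered_eq: "maximal_centered P = range (members_through P)"
proof (intro equalityI subsetI)
  fix U assume U: "U \<in> maximal_centered P"
  then obtain x where "U \<subseteq> members_through P x"
    unfolding maximal_centered_def using centered_subset_members_through by blast
  with U show "U \<in> range (members_through P)"
    unfolding maximal_centered_def using centered_members_through by blast
next
  fix U assume "U \<in> range (members_through P)"
  then obtain x where U: "U = members_through P x"
    by blast
  have "V = U" if V: "centered P V" "U \<subseteq> V" for V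
  proof -
    obtain y where y: "V \<subseteq> members_through P y"
      using V(1) by (rule centered_subset_members_through)
    with V(2) U have "members_through P x \<subseteq> members_through P y"
      by simp
    then have "x = y"
      by (rule members_through_subset_imp_eq)
    with y V(2) U show ?thesis
      by simp
  qed
  then show "U \<in> maximal_centered P"
    unfolding maximal_centered_def using centered_members_through U by blast
qed

section \<open>Comparison of the two topologies\<close>

lemma inj_members_through: "inj (members_through P)"
  by (rule injI) (simp add: members_through_subset_imp_eq)

text \<open>Finitely many members inside \<open>U\<close> have interiors covering \<open>K\<close>;
  their union is \<open>A\<close>. Taking for \<open>U\<close> the complement of a point outside
  \<open>K\<close> separates that point from \<open>K\<close> by a member of
  \<open>P\<close>.\<close>

lemma compact_subset_member:
  assumes "compact K" "K \<noteq> {}" "open U" "K \<subseteq> U"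
  obtains A where "A \<in> P" "K \<subseteq> A" "A \<subseteq> U"
proof -
  define \<C> where "\<C> = {A \<in> P. A \<subseteq> U}"
  have cover: "K \<subseteq> (\<Union>A\<in>\<C>. interior A)"
    using small_neighbourhood[OF assms(3)] assms(4) unfolding \<C>_def by blast
  obtain \<D> where D: "\<D> \<subseteq> \<C>" "finite \<D>" "K \<subseteq> (\<Union>A\<in>\<D>. interior A)"
    by (rule compactE_image[OF assms(1) open_interior cover])
  have "\<Union>\<D> \<in> P"
    using D assms(2) by (intro Union_closed) (auto simp: \<C>_def)
  moreover have "K \<subseteq> \<Union>\<D>"
    using D(3) interior_subset by blast
  moreover have "\<Union>\<D> \<subseteq> U"
    using D(1) by (auto simp: \<C>_def)
  ultimately show thesis
    by (rule that)
qed

lemma members_through_vimage: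
  "members_through P -` maximal_centered_containing P A = (if A \<in> P then A else {})"
  by (auto simp: maximal_centered_containing_def maximal_centered_eq members_through_def)

lemma members_through_vimage_maximal_centered: "members_through P -` maximal_centered P = UNIV"
  by (auto simp: maximal_centered_eq)

text \<open>The subbasic closed set of \<open>A\<close> pulls back to \<open>A\<close> itself, which
  is compact and hence co-compact closed.\<close>

lemma continuous_map_members_through:
  "continuous_map (cocompact_topology euclidean) (maximal_centered_topology P)
     (members_through P)"
  unfolding maximal_centered_topology_def closed_subbase_topology_def
    continuous_on_generated_topo_iff
proof (intro conjI allI impI)
  fix V
  assume "V \<in> insert (maximal_centered P) ((\<lambda>C. maximal_centered P - C) `
    maximal_centered_containing P ` P)"
  then consider "V = maximal_centered P"
    | A where "A \<in> P" "V = maximal_centered P - maximal_centered_containing P A"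
    by blast
  then show "openin (cocompact_topology euclidean)
      (members_through P -` V \<inter> topspace (cocompact_topology euclidean))"
  proof cases
    case 1
    then show ?thesis
      using openin_topspace[of "cocompact_topology (euclidean :: 'a topology)"]
      by (simp add: members_through_vimage_maximal_centered)
  next
    case 2
    then have "members_through P -` V = - A"
      by (simp add: vimage_Diff members_through_vimage members_through_vimage_maximal_centered
          Compl_eq_Diff_UNIV)
    then show ?thesis
      using openin_cocompact_euclidean_Compl[OF compact[OF 2(1)]] by simp
  qed
next
  show "members_through P ` topspace (cocompact_topology euclidean)
      \<subseteq> \<Union>(insert (maximal_centered P)
            ((\<lambda>C. maximal_centered P - C) ` maximal_centered_containing P ` P))"
    unfolding maximal_centered_eq by blast
qed

text \<open>For each \<open>x\<close> outside \<open>K\<close>, a member \<open>A\<close> containing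
  \<open>K\<close> but not \<open>x\<close> gives a subbasic open set that contains the family of
  \<open>x\<close> and stays inside the image.\<close>

lemma openin_members_through_image_Compl:
  assumes "compact K"
  shows "openin (maximal_centered_topology P) (members_through P ` (- K))"
proof (subst openin_subopen, intro ballI)
  fix U assume "U \<in> members_through P ` (- K)"
  then obtain x where x: "x \<notin> K" "U = members_through P x"
    by blast
  show "\<exists>T. openin (maximal_centered_topology P) T \<and> U \<in> T \<and> T \<subseteq> members_through P ` (- K)"
  \<comment> \<open>Enclosing \<open>K\<close> in a member requires \<open>K\<close> nonempty; for
    empty \<open>K\<close> the image is the whole carrier.\<close>
  proof (cases "K = {}")
    case True
    then have "members_through P ` (- K) = topspace (maximal_centered_topology P)"
      by (simp add: maximal_centered_topology_def maximal_centered_eq)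
    then show ?thesis
      using x openin_topspace[of "maximal_centered_topology P"] by auto
  next
    case False
    then obtain A where A: "A \<in> P" "K \<subseteq> A" "A \<subseteq> - {x}"
      using compact_subset_member[of K "- {x}"] assms x by auto
    let ?T = "maximal_centered P - maximal_centered_containing P A"
    have "openin (maximal_centered_topology P) ?T"
      unfolding maximal_centered_topology_def closed_subbase_topology_def
      using A(1) by (intro topology_generated_by_Basis) blast
    moreover have "U \<in> ?T" "?T \<subseteq> members_through P ` (- K)"
      using A x
      by (auto simp: maximal_centered_containing_def maximal_centered_eq members_through_def)
    ultimately show ?thesis
      by blast
  qed
qed

theorem maximal_centered_topology_homeomorphic_cocompact:
  "maximal_centered_topology P homeomorphic_space cocompact_topology (euclidean :: 'a topology)"
proof -
  have "open_map (cocompact_topology euclidean) (maximal_centered_topology P) (members_through P)"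
    unfolding open_map_def
  proof (intro allI impI)
    fix S :: "'a set"
    assume "openin (cocompact_topology euclidean) S"
    \<comment> \<open>Images commute with unions, so openness need only be checked on complements of
      compact sets.\<close>
    then obtain \<U> where U: "S = \<Union>\<U>"
      "\<U> \<subseteq> {V. \<exists>K. compactin euclidean K \<and> saturatedin euclidean K \<and> V = topspace euclidean - K}"
      unfolding openin_cocompact_topology union_of_def by blast
    have "openin (maximal_centered_topology P) (members_through P ` V)" if "V \<in> \<U>" for V
    proof -
      obtain K where "compact K" "V = - K"
        using U(2) \<open>V \<in> \<U>\<close> by (auto simp: compactin_euclidean_iff)
      then show ?thesis
        using openin_members_through_image_Compl by simp
    qed
    then show "openin (maximal_centered_topology P) (members_through P ` S)"
      unfolding U(1) image_Union by blast
  qed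
  then have "homeomorphic_map (cocompact_topology euclidean) (maximal_centered_topology P)
      (members_through P)"
    by (intro bijective_open_imp_homeomorphic_map continuous_map_members_through)
       (auto simp: maximal_centered_topology_def maximal_centered_eq inj_members_through)
  then show ?thesis
    using homeomorphic_map_imp_homeomorphic_space homeomorphic_space_sym by blast
qed

end

section \<open>The causal order in coordinates and small diamonds\<close>

lemma causal_le_iff:
  "causal_le p q \<longleftrightarrow> p$1 \<le> q$1 \<and>
     (q$2 - p$2)\<^sup>2 + (q$3 - p$3)\<^sup>2 + (q$4 - p$4)\<^sup>2 \<le> (q$1 - p$1)\<^sup>2"
  by (auto simp: causal_le_def minkowski_form_coords power2_eq_square)

lemma causal_le_imp_abs_le:
  assumes "causal_le p q"
  shows "\<bar>q$i - p$i\<bar> \<le> q$1 - p$1"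
proof -
  have "(q$i - p$i)\<^sup>2 \<le> (q$1 - p$1)\<^sup>2"
    using assms exhaust_4[of i] unfolding causal_le_iff
    by (smt (verit) zero_le_power2)
  then have "\<bar>q$i - p$i\<bar> \<le> \<bar>q$1 - p$1\<bar>"
    by (simp add: abs_le_square_iff)
  then show ?thesis
    using assms by (simp add: causal_le_iff)
qed

text \<open>Three spatial squares, each at most a quarter of the squared time difference, sum to at
  most three quarters of it. This replaces the quadratic cone by linear bounds.\<close>

lemma causal_leI:
  assumes "\<And>i. i \<noteq> 1 \<Longrightarrow> \<bar>q$i - p$i\<bar> \<le> (q$1 - p$1) / 2"
  shows "causal_le p q"
proof -
  have bound: "4 * (q$i - p$i)\<^sup>2 \<le> (q$1 - p$1)\<^sup>2" if "i \<noteq> 1" for i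
  proof -
    have "\<bar>q$i - p$i\<bar>\<^sup>2 \<le> ((q$1 - p$1) / 2)\<^sup>2"
      using assms[OF that] by (rule power_mono) (rule abs_ge_zero)
    also have "\<dots> = (q$1 - p$1)\<^sup>2 / 4"
      unfolding power_divide by simp
    finally show ?thesis
      unfolding power2_abs by linarith
  qed
  \<comment> \<open>The bound on any spatial coordinate dominates an absolute value, so the time
    difference is nonnegative.\<close>
  have "0 \<le> (q$1 - p$1) / 2"
    by (rule order_trans[OF abs_ge_zero assms[of 2]]) simp
  then have "p$1 \<le> q$1"
    by simp
  moreover have "(q$2 - p$2)\<^sup>2 + (q$3 - p$3)\<^sup>2 + (q$4 - p$4)\<^sup>2 \<le> (q$1 - p$1)\<^sup>2"
  proof -
    have "(2::4) \<noteq> 1" "(3::4) \<noteq> 1" "(4::4) \<noteq> 1"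
      by simp_all
    note this[THEN bound]
    then show ?thesis
      using zero_le_power2[of "q$1 - p$1"] by linarith
  qed
  ultimately show ?thesis
    by (simp add: causal_le_iff)
qed

text \<open>Polynomial inequalities give closedness. A point of the diamond is at most
  \<open>q$1 - p$1\<close> later than \<open>p\<close>, and this time gap bounds every coordinate
  difference.\<close>

lemma compact_diamond: "compact (diamond p q)"
proof -
  have "closed {x. causal_le p x}" "closed {x. causal_le x q}"
    unfolding causal_le_iff
    by (intro closed_Collect_conj closed_Collect_le continuous_intros)+
  then have "closed (diamond p q)"
    by (auto simp: diamond_def causal_future_def causal_past_def)
  moreover have "diamond p q \<subseteq> cbox (\<chi> i. p$i - (q$1 - p$1)) (\<chi> i. p$i + (q$1 - p$1))"
  proof
    fix x assume "x \<in> diamond p q"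
    then have x: "causal_le p x" "causal_le x q"
      by (auto simp: diamond_def causal_future_def causal_past_def)
    have "p$i - (q$1 - p$1) \<le> x$i \<and> x$i \<le> p$i + (q$1 - p$1)" for i
      using causal_le_imp_abs_le[OF x(1), of i] x(2) by (simp add: causal_le_iff abs_le_iff)
    then show "x \<in> cbox (\<chi> i. p$i - (q$1 - p$1)) (\<chi> i. p$i + (q$1 - p$1))"
      by (simp add: mem_box_cart)
  qed
  ultimately show ?thesis
    using bounded_subset[OF bounded_cbox] compact_eq_bounded_closed by blast
qed

lemma rational_vector_between:
  fixes a b :: "'n::finite \<Rightarrow> real"
  assumes "\<And>i. a i < b i"
  shows "\<exists>p::real^'n. \<forall>i. p$i \<in> \<rat> \<and> a i < p$i \<and> p$i < b i"
proof -
  have "\<forall>i. \<exists>r. r \<in> \<rat> \<and> a i < r \<and> r < b i"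
    using Rats_dense_in_real assms by blast
  then obtain r where "\<forall>i. r i \<in> \<rat> \<and> a i < r i \<and> r i < b i"
    by metis
  then show ?thesis
    by (intro exI[of _ "\<chi> i. r i"]) simp
qed

lemma small_rational_diamond:
  fixes x :: "real^4"
  assumes "open U" "x \<in> U"
  shows "\<exists>A\<in>rational_diamonds. x \<in> interior A \<and> A \<subseteq> U"
proof -
  obtain e where e: "e > 0" "ball x e \<subseteq> U"
    using assms openE by blast
  \<comment> \<open>Points of the diamond will be within \<open>6 * d\<close> of \<open>p\<close>,
    hence \<open>9 * d\<close> of \<open>x\<close>, in each of the four coordinates; the sum
    \<open>36 * d\<close> is below \<open>e\<close>.\<close>
  define d where "d = e / 40"
  have "d > 0"
    using e by (simp add: d_def)
  \<comment> \<open>The tips lie between \<open>2 * d\<close> and \<open>3 * d\<close> before and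
    after \<open>x\<close>, almost on its time axis. For \<open>y\<close> within \<open>d/4\<close>
    of \<open>x\<close>, half the time gap to a tip exceeds \<open>7 * d / 8\<close>, while spatial
    gaps stay below \<open>d/2\<close>.\<close>
  have "\<exists>p::real^4. \<forall>i. p$i \<in> \<rat> \<and> x$i + (if i = 1 then - 3 * d else - d/4) < p$i \<and>
      p$i < x$i + (if i = 1 then - 2 * d else d/4)"
    by (rule rational_vector_between) (simp add: \<open>d > 0\<close>)
  then obtain p where p: "\<And>i. p$i \<in> \<rat>"
      "\<And>i. x$i + (if i = 1 then - 3 * d else - d/4) < p$i"
      "\<And>i. p$i < x$i + (if i = 1 then - 2 * d else d/4)"
    by blast
  have "\<exists>q::real^4. \<forall>i. q$i \<in> \<rat> \<and> x$i + (if i = 1 then 2 * d else - d/4) < q$i \<and>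
      q$i < x$i + (if i = 1 then 3 * d else d/4)"
    by (rule rational_vector_between) (simp add: \<open>d > 0\<close>)
  then obtain q where q: "\<And>i. q$i \<in> \<rat>"
      "\<And>i. x$i + (if i = 1 then 2 * d else - d/4) < q$i"
      "\<And>i. q$i < x$i + (if i = 1 then 3 * d else d/4)"
    by blast
  have p1: "x$1 - 3 * d < p$1" "p$1 < x$1 - 2 * d"
    and q1: "x$1 + 2 * d < q$1" "q$1 < x$1 + 3 * d"
    using p(2,3)[of 1] q(2,3)[of 1] by simp_all
  have p_bounds: "x$i - d/4 < p$i" "p$i < x$i + d/4" if "i \<noteq> 1" for i
    using p(2,3)[of i] that by simp_all
  have q_bounds: "x$i - d/4 < q$i" "q$i < x$i + d/4" if "i \<noteq> 1" for i
    using q(2,3)[of i] that by simp_all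
  have p_bounds': "x$i - 3 * d < p$i" "p$i < x$i + 3 * d" for i
    using p_bounds[of i] p1 \<open>d > 0\<close> by (cases "i = 1"; force)+
  have "causal_le p q"
  proof (rule causal_leI)
    show "\<bar>q$i - p$i\<bar> \<le> (q$1 - p$1) / 2" if "i \<noteq> 1" for i
      by (rule abs_leI; use p_bounds[OF that] q_bounds[OF that] p1 q1 \<open>d > 0\<close> in argo)
  qed
  then have "diamond p q \<in> rational_diamonds"
    using p(1) q(1) unfolding rational_diamonds_def by blast
  moreover have "ball x (d/4) \<subseteq> diamond p q"
  proof
    fix y assume "y \<in> ball x (d/4)"
    then have "\<bar>y$i - x$i\<bar> < d/4" for i
      using component_le_norm_cart[of "y - x" i] by (simp add: dist_norm norm_minus_commute)
    then have y: "x$i - d/4 < y$i" "y$i < x$i + d/4" for i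
      unfolding abs_diff_less_iff by simp_all
    have "causal_le p y"
    proof (rule causal_leI)
      show "\<bar>y$i - p$i\<bar> \<le> (y$1 - p$1) / 2" if "i \<noteq> 1" for i
        by (rule abs_leI; use p_bounds[OF that] y[of i] y[of 1] p1 \<open>d > 0\<close> in argo)
    qed
    moreover have "causal_le y q"
    proof (rule causal_leI)
      show "\<bar>q$i - y$i\<bar> \<le> (q$1 - y$1) / 2" if "i \<noteq> 1" for i
        by (rule abs_leI; use q_bounds[OF that] y[of i] y[of 1] q1 \<open>d > 0\<close> in argo)
    qed
    ultimately show "y \<in> diamond p q"
      by (simp add: diamond_def causal_future_def causal_past_def)
  qed
  then have "x \<in> interior (diamond p q)"
    unfolding mem_interior using \<open>d > 0\<close> by (intro exI[of _ "d/4"]) simp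
  moreover have "diamond p q \<subseteq> ball x e"
  proof
    fix z assume "z \<in> diamond p q"
    then have z: "causal_le p z" "causal_le z q"
      by (auto simp: diamond_def causal_future_def causal_past_def)
    have "\<bar>z$i - p$i\<bar> \<le> 6 * d" for i
      using causal_le_imp_abs_le[OF z(1), of i] z(2) p1 q1 by (simp add: causal_le_iff)
    then have "z$i - p$i \<le> 6 * d" "- (z$i - p$i) \<le> 6 * d" for i
      by (simp_all add: abs_le_iff)
    then have "\<bar>z$i - x$i\<bar> \<le> 9 * d" for i
      by (intro abs_leI) (smt (verit) p_bounds'[of i])+
    then have "(\<Sum>i\<in>UNIV. \<bar>(z - x)$i\<bar>) \<le> (\<Sum>i\<in>(UNIV::4 set). 9 * d)"
      by (intro sum_mono) simp
    then have "norm (z - x) \<le> 36 * d"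
      using norm_le_l1_cart[of "z - x"] by simp
    also have "\<dots> < e"
      using e by (simp add: d_def)
    finally show "z \<in> ball x e"
      by (simp add: dist_norm norm_minus_commute)
  qed
  ultimately show ?thesis
    using e(2) by blast
qed

section \<open>The lattice of rational diamonds\<close>

lemma set_lattice_generated_by_compact:
  fixes G :: "'a::t2_space set set"
  assumes "A \<in> set_lattice_generated_by G" "\<And>B. B \<in> G \<Longrightarrow> compact B"
  shows "compact A"
  using assms(1) by induction (auto intro: assms(2) compact_Int)

theorem theorem4p3:
  "maximal_centered_topology (set_lattice_generated_by rational_diamonds)
     homeomorphic_space cocompact_topology (euclidean :: (real^4) topology)"
proof -
  interpret compact_neighbourhood_lattice "set_lattice_generated_by rational_diamonds"
  proof
    show "compact A" if "A \<in> set_lattice_generated_by rational_diamonds" for A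
      using that by (rule set_lattice_generated_by_compact)
        (auto simp: rational_diamonds_def compact_diamond)
    \<comment> \<open>A single generator already provides the small neighbourhood.\<close>
    show "\<exists>A\<in>set_lattice_generated_by rational_diamonds. x \<in> interior A \<and> A \<subseteq> U"
      if "open U" "x \<in> U" for U x
      using small_rational_diamond[OF that] set_lattice_generated_by.base by blast
  qed (auto intro: set_lattice_generated_by.union set_lattice_generated_by.inter)
  show ?thesis
    by (rule maximal_centered_topology_homeomorphic_cocompact)
qed

end
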